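(* Let $d,n\ge 1$ be integers and let $\mathcal{H}_{\mathrm{POVM}}=\{M\in\mathbb{C}^{d\times d}:0\le M\le I\}$. For any $n$ density matrices $\rho_1,\dots,\rho_n$ of size $d\times d$, $$\hat{\mathcal{R}}_n^{(\infty)}(\mathcal{H}_{\mathrm{POVM}})\le\sqrt{\frac dn}.$$
   Context: A density matrix is a $d\times d$ complex positive semidefinite matrix of trace $1$. Inequalities $0\le M\le I$ are in the Loewner order on Hermitian matrices, with $I$ the $d\times d$ identity. The (infinite-shot) empirical Rademacher complexity of $\mathcal{H}_{\mathrm{POVM}}$ on the states $\rho_1,\dots,\rho_n$ is $$\hat{\mathcal{R}}_n^{(\infty)}(\mathcal{H}_{\mathrm{POVM}})=\mathbb{E}_{\boldsymbol\sigma}\left[\sup_{M\in\mathcal{H}_{\mathrm{POVM}}}\frac1n\sum_{i=1}^n\sigma_i\,\mathrm{Tr}(M\rho_i)\right],$$ where $\boldsymbol\sigma=(\sigma_1,\dots,\sigma_n)$ has i.i.d. entries uniform on $\{-1,+1\}$. *)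

theory Defs
  imports "HOL-Probability.Probability"
begin

definition adjoint_mat :: "complex^'n^'m \<Rightarrow> complex^'m^'n" where
  "adjoint_mat A = (\<chi> i j. cnj (A $ j $ i))"

definition hermitian :: "complex^'d^'d \<Rightarrow> bool" where
  "hermitian A \<longleftrightarrow> adjoint_mat A = A"

text \<open>For Hermitian \<open>A\<close> the form \<open>x\<^sup>* A x\<close> is real-valued, so taking \<open>Re\<close> loses nothing.\<close>

definition psd :: "complex^'d^'d \<Rightarrow> bool" where
  "psd A \<longleftrightarrow> hermitian A \<and> (\<forall>x. 0 \<le> Re (\<Sum>i\<in>UNIV. cnj (x $ i) * (A *v x) $ i))"

definition loewner_le :: "complex^'d^'d \<Rightarrow> complex^'d^'d \<Rightarrow> bool" where
  "loewner_le A B \<longleftrightarrow> hermitian A \<and> hermitian B \<and> psd (B - A)"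

definition density_matrix :: "complex^'d^'d \<Rightarrow> bool" where
  "density_matrix \<rho> \<longleftrightarrow> psd \<rho> \<and> trace \<rho> = 1"

text \<open>\<open>mat 1\<close> is the identity matrix. The order \<open>\<le>\<close> that the library puts on vectors
  is componentwise, hence the separate \<open>loewner_le\<close>.\<close>

definition H_POVM :: "(complex^'d^'d) set" where
  "H_POVM = {M. loewner_le 0 M \<and> loewner_le M (mat 1)}"

text \<open>The law of \<open>(\<sigma>\<^sub>1, \<dots>, \<sigma>\<^sub>n)\<close>, i.i.d. uniform signs; coordinates
  outside \<open>{1..n}\<close> are constantly \<open>0\<close>.\<close>

definition rademacher_pmf :: "nat \<Rightarrow> (nat \<Rightarrow> real) pmf" where
  "rademacher_pmf n = Pi_pmf {1..n} 0 (\<lambda>_. pmf_of_set {-1, 1})"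

text \<open>The traces are real when \<open>M\<close> and the \<open>\<rho> i\<close> are Hermitian (lemma
  \<open>trace_mult_hermitian_real\<close>); \<open>Re\<close> only converts the type. For \<open>H = H_POVM\<close> the
  supremum is over a nonempty set of reals that is bounded above, \<open>H_POVM\<close> being compact.\<close>

definition emp_rademacher ::
    "nat \<Rightarrow> (nat \<Rightarrow> complex^'d^'d) \<Rightarrow> (complex^'d^'d) set \<Rightarrow> real" where
  "emp_rademacher n \<rho> H =
     measure_pmf.expectation (rademacher_pmf n)
       (\<lambda>\<sigma>. SUP M\<in>H. (1 / real n) * (\<Sum>i=1..n. \<sigma> i * Re (trace (M ** \<rho> i))))"

lemma trace_mult_hermitian_real:
  fixes A B :: "complex^'d^'d"
  assumes "hermitian A" "hermitian B"
  shows "trace (A ** B) \<in> \<real>"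
proof -
  have A: "cnj (A $ i $ j) = A $ j $ i" for i j
    using assms(1) unfolding hermitian_def adjoint_mat_def vec_eq_iff by simp
  have B: "cnj (B $ i $ j) = B $ j $ i" for i j
    using assms(2) unfolding hermitian_def adjoint_mat_def vec_eq_iff by simp
  have "cnj (trace (A ** B)) = (\<Sum>i\<in>UNIV. \<Sum>k\<in>UNIV. A $ k $ i * B $ i $ k)"
    by (simp add: trace_def matrix_matrix_mult_def A B)
  also have "\<dots> = trace (A ** B)"
    unfolding trace_def matrix_matrix_mult_def by (subst sum.swap) simp
  finally show ?thesis
    by (simp add: Reals_cnj_iff)
qed

end

(* Write S for the signed sum of the states. For a Hermitian effect M, Tr(M S) is the real inner
   product of M and S as matrices, so Cauchy-Schwarz bounds the supremum by the Frobenius norm of S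
   times the largest Frobenius norm of an effect. The latter is at most sqrt d, since every row of an
   effect has norm at most 1. Orthogonality of the signs gives E |S|^2 = sum of |rho_i|^2, which is
   at most n because a density matrix has Frobenius norm at most 1. *)

theory Submission
  imports Defs
begin

section \<open>Cauchy-Schwarz for positive semidefinite forms\<close>

text \<open>The quadratic form inside \<open>psd\<close>, polarised to two arguments and
  conjugate-linear in the first, so that Cauchy-Schwarz can be stated for it.\<close>

definition sesq :: "complex^'d^'d \<Rightarrow> complex^'d \<Rightarrow> complex^'d \<Rightarrow> complex" where
  "sesq A x y = (\<Sum>i\<in>UNIV. cnj (x $ i) * (A *v y) $ i)"

lemma psd_sesq_nonneg: "psd A \<Longrightarrow> 0 \<le> Re (sesq A x x)"
  by (simp add: psd_def sesq_def)

lemma sesq_expand: "sesq A x y = (\<Sum>i\<in>UNIV. \<Sum>j\<in>UNIV. cnj (x $ i) * A $ i $ j * y $ j)"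
  by (simp add: sesq_def matrix_vector_mult_def sum_distrib_left mult.assoc)

lemma hermitian_nth: "hermitian A \<Longrightarrow> cnj (A $ i $ j) = A $ j $ i"
  unfolding hermitian_def adjoint_mat_def vec_eq_iff by simp

lemma sesq_swap:
  assumes "hermitian A"
  shows "sesq A y x = cnj (sesq A x y)"
  unfolding sesq_expand
  by (subst sum.swap) (simp add: hermitian_nth[OF assms] mult_ac)

lemma sesq_add_scale:
  "sesq A (x + c *s y) (x + c *s y)
    = sesq A x x + c * sesq A x y + cnj c * sesq A y x + cnj c * c * sesq A y y"
  unfolding sesq_expand
  by (simp only: sum_distrib_left sum.distrib[symmetric], intro sum.cong refl)
    (simp add: algebra_simps)

lemma sesq_axis: "sesq A (axis i 1) (axis j 1) = A $ i $ j"
proof -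
  have "sesq A (axis i 1) (axis j 1)
      = (\<Sum>k\<in>UNIV. if k = i then (\<Sum>l\<in>UNIV. if l = j then A $ k $ l else 0) else 0)"
    unfolding sesq_expand by (intro sum.cong refl) (simp add: axis_def if_distrib cong: if_cong)
  then show ?thesis by simp
qed

text \<open>The form may be degenerate, so the argument is the classical discriminant one:
  nonnegativity along a line through \<open>x\<close> in the direction of a multiple of
  \<open>y\<close> gives a real quadratic in \<open>t\<close>, evaluated at a suitable
  \<open>t\<close>.\<close>

lemma psd_cauchy_schwarz:
  assumes "psd A"
  shows "(cmod (sesq A x y))\<^sup>2 \<le> Re (sesq A x x) * Re (sesq A y y)"
proof -
  define a b c where "a = Re (sesq A x x)" and "b = Re (sesq A y y)" and "c = sesq A x y"
  have herm: "hermitian A" using assms by (simp add: psd_def)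
  have quad: "0 \<le> a + 2 * t * (cmod c)\<^sup>2 + t\<^sup>2 * (cmod c)\<^sup>2 * b" for t :: real
  proof -
    \<comment> \<open>The factor \<open>cnj c\<close> aligns the phase: both cross terms become the
      same real number \<open>t * (cmod c)\<^sup>2\<close>.\<close>
    define z where "z = of_real t * cnj c"
    have yx: "sesq A y x = cnj c" unfolding c_def by (rule sesq_swap[OF herm])
    have "z * c = of_real (t * (cmod c)\<^sup>2)" "cnj z * cnj c = of_real (t * (cmod c)\<^sup>2)"
      "cnj z * z = of_real (t\<^sup>2 * (cmod c)\<^sup>2)"
      unfolding z_def using complex_norm_square[of c]
      by (simp_all add: mult_ac power2_eq_square)
    then have "Re (sesq A (x + z *s y) (x + z *s y))
        = a + t * (cmod c)\<^sup>2 + t * (cmod c)\<^sup>2 + t\<^sup>2 * (cmod c)\<^sup>2 * b"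
      unfolding sesq_add_scale yx c_def[symmetric] by (simp add: a_def b_def del: of_real_mult)
    with psd_sesq_nonneg[OF assms, of "x + z *s y"] show ?thesis by simp
  qed
  have "b \<ge> 0" unfolding b_def by (rule psd_sesq_nonneg[OF assms])
  have "(cmod c)\<^sup>2 \<le> a * b"
  proof (cases "b = 0")
    case True
    have "(cmod c)\<^sup>2 = 0"
    proof (rule ccontr)
      assume "(cmod c)\<^sup>2 \<noteq> 0"
      \<comment> \<open>With \<open>b = 0\<close> the quadratic is affine in \<open>t\<close>, and
        this \<open>t\<close> gives it the value -1.\<close>
      then show False using quad[of "- (a + 1) / (2 * (cmod c)\<^sup>2)"] True
        by (simp add: field_simps)
    qed
    then show ?thesis using True by simp
  next
    case False
    then have "b > 0" using \<open>b \<ge> 0\<close> by simp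
    \<comment> \<open>When \<open>c\<close> is nonzero, \<open>- 1 / b\<close> is the minimiser; the
      value there is \<open>a - (cmod c)\<^sup>2 / b\<close>.\<close>
    then show ?thesis using quad[of "- 1 / b"]
      by (simp add: field_simps power2_eq_square)
  qed
  then show ?thesis by (simp add: a_def b_def c_def)
qed

section \<open>Frobenius norms of states and effects\<close>

lemma norm_vec_sq: "(norm x)\<^sup>2 = (\<Sum>i\<in>UNIV. (norm (x $ i))\<^sup>2)"
  by (simp add: norm_vec_def L2_set_def sum_nonneg)

lemma sesq_diff: "sesq (A - B) x y = sesq A x y - sesq B x y"
  by (simp add: sesq_expand algebra_simps sum_subtractf)

lemma sesq_mat_1: "Re (sesq (mat 1) x x) = (norm x)\<^sup>2"
  by (simp add: sesq_def norm_vec_sq cmod_power2) (simp add: power2_eq_square)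

text \<open>Cauchy-Schwarz at basis vectors bounds the squared modulus of entry (i, j) by the
  product of the diagonal entries i and j; the double sum of these products factors into the squared
  trace.\<close>

lemma density_matrix_norm_le_1:
  assumes "density_matrix \<rho>"
  shows "norm \<rho> \<le> 1"
proof -
  have psd: "psd \<rho>" and tr: "trace \<rho> = 1" using assms by (auto simp: density_matrix_def)
  have "(norm \<rho>)\<^sup>2 = (\<Sum>i\<in>UNIV. \<Sum>j\<in>UNIV. (cmod (\<rho> $ i $ j))\<^sup>2)"
    by (simp add: norm_vec_sq)
  also have "\<dots> \<le> (\<Sum>i\<in>UNIV. \<Sum>j\<in>UNIV. Re (\<rho> $ i $ i) * Re (\<rho> $ j $ j))"
    using psd_cauchy_schwarz[OF psd, of "axis _ 1" "axis _ 1"]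
    by (intro sum_mono) (simp add: sesq_axis)
  also have "\<dots> = (Re (trace \<rho>))\<^sup>2"
    by (simp add: trace_def power2_eq_square sum_product)
  finally show ?thesis using tr power2_le_imp_le[of "norm \<rho>" 1] by simp
qed

text \<open>Let y be the image under M of the i-th basis vector e. Cauchy-Schwarz for the form of M
  at y and e gives |y|^4 \<le> (y* M y)(e* M e), and M \<le> I bounds the right side by |y|^2. Hence
  |y| \<le> 1, and the squared row norms sum to at most d.\<close>

lemma povm_norm_le:
  fixes M :: "complex^'d^'d"
  assumes "M \<in> H_POVM"
  shows "norm M \<le> sqrt (real CARD('d))"
proof -
  have herm: "hermitian M" and psd: "psd M" and psd': "psd (mat 1 - M)"
    using assms by (auto simp: H_POVM_def loewner_le_def)
  have le: "Re (sesq M x x) \<le> (norm x)\<^sup>2" for x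
    using psd_sesq_nonneg[OF psd', of x] by (simp add: sesq_diff sesq_mat_1)
  have row: "(norm (M $ i))\<^sup>2 \<le> 1" for i
  proof -
    define y where "y = M *v axis i 1"
    \<comment> \<open>Column i is the conjugate of row i, so the two have equal norm.\<close>
    have y: "y $ j = cnj (M $ i $ j)" for j
      by (simp add: y_def matrix_vector_mult_def axis_def if_distrib hermitian_nth[OF herm] cong: if_cong)
    have norm_y: "norm y = norm (M $ i)" by (simp add: norm_vec_def y)
    have "sesq M y (axis i 1) = of_real ((norm y)\<^sup>2)"
      unfolding sesq_def norm_vec_sq y_def[symmetric] of_real_sum
      by (intro sum.cong refl) (metis complex_norm_square mult.commute)
    then have "((norm y)\<^sup>2)\<^sup>2 = (cmod (sesq M y (axis i 1)))\<^sup>2"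
      by (simp only: norm_of_real power2_abs)
    also have "\<dots> \<le> Re (sesq M y y) * Re (sesq M (axis i 1) (axis i 1))"
      by (rule psd_cauchy_schwarz[OF psd])
    also have "\<dots> \<le> (norm y)\<^sup>2 * 1"
      using le[of y] le[of "axis i 1"] psd_sesq_nonneg[OF psd]
      by (intro mult_mono) (auto simp: norm_axis_1)
    finally have "(norm y)\<^sup>2 * (norm y)\<^sup>2 \<le> (norm y)\<^sup>2 * 1" by (simp add: power2_eq_square)
    then have "(norm y)\<^sup>2 \<le> 1" by (cases "norm y = 0") (simp_all only: mult_le_cancel_left, auto)
    then show ?thesis by (simp add: norm_y)
  qed
  have "(norm M)\<^sup>2 = (\<Sum>i\<in>UNIV. (norm (M $ i))\<^sup>2)" by (rule norm_vec_sq)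
  also have "\<dots> \<le> (\<Sum>i\<in>(UNIV::'d set). 1)" by (intro sum_mono row)
  finally show ?thesis by (simp add: real_le_rsqrt)
qed

text \<open>Hermitian symmetry turns the transposed entry of \<open>B\<close> into a conjugate, and
  the real inner product of complex numbers is the real part of one times the conjugate of the
  other.\<close>

lemma Re_trace_mult_hermitian:
  assumes "hermitian B"
  shows "Re (trace (A ** B)) = A \<bullet> B"
proof -
  have "Re (A $ i $ j * B $ j $ i) = A $ i $ j \<bullet> B $ i $ j" for i j
    by (subst hermitian_nth[OF assms, of i j, symmetric]) (simp add: inner_complex_def)
  then show ?thesis
    by (simp only: trace_def matrix_matrix_mult_def inner_vec_def vec_lambda_beta Re_sum)
qed

text \<open>Supplies the nonemptiness needed to bound the supremum.\<close>

lemma zero_in_H_POVM: "0 \<in> H_POVM"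
proof -
  have "hermitian 0" "hermitian (mat 1)"
    by (auto simp: hermitian_def adjoint_mat_def vec_eq_iff mat_def)
  moreover have "psd 0" "psd (mat 1)"
    using calculation by (simp_all add: psd_def sum_nonneg)
  ultimately show ?thesis by (simp add: H_POVM_def loewner_le_def)
qed

section \<open>Moments of Rademacher sums\<close>

text \<open>Finite support makes every real function of the signs integrable, including the
  supremum.\<close>

lemma finite_set_rademacher: "finite (set_pmf (rademacher_pmf n))"
  unfolding rademacher_pmf_def
  by (intro finite_subset[OF set_Pi_pmf_subset'] finite_PiE_dflt) auto

lemma rademacher_sign:
  assumes "\<sigma> \<in> set_pmf (rademacher_pmf n)" "i \<in> {1..n}"
  shows "\<sigma> i * \<sigma> i = 1"
  using assms by (auto simp: rademacher_pmf_def set_Pi_pmf PiE_dflt_def)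

text \<open>On the diagonal the square of a sign is 1; off it, independence factors the expectation
  into two zero means.\<close>

lemma rademacher_correlation:
  assumes "i \<in> {1..n}" "j \<in> {1..n}"
  shows "measure_pmf.expectation (rademacher_pmf n) (\<lambda>\<sigma>. \<sigma> i * \<sigma> j) = (if i = j then 1 else 0)"
proof (cases "i = j")
  case True
  have "measure_pmf.expectation (rademacher_pmf n) (\<lambda>\<sigma>. \<sigma> i * \<sigma> i)
      = measure_pmf.expectation (rademacher_pmf n) (\<lambda>_. 1 :: real)"
    by (intro integral_cong_AE AE_pmfI) (use rademacher_sign assms in auto)
  then show ?thesis using True by simp
next
  case False
  let ?E = "measure_pmf.expectation (rademacher_pmf n)"
  have mean: "?E (\<lambda>\<sigma>. \<sigma> k) = 0" if "k \<in> {1..n}" for k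
  proof -
    have "?E (\<lambda>\<sigma>. \<sigma> k)
        = measure_pmf.expectation (map_pmf (\<lambda>\<sigma>. \<sigma> k) (rademacher_pmf n)) (\<lambda>s. s)"
      by simp
    also have "map_pmf (\<lambda>\<sigma>. \<sigma> k) (rademacher_pmf n) = pmf_of_set {-1, 1}"
      using that by (simp add: rademacher_pmf_def Pi_pmf_component)
    finally show ?thesis by (simp add: integral_pmf_of_set)
  qed
  have "prob_space.indep_vars (rademacher_pmf n) (\<lambda>_. count_space UNIV) (\<lambda>k \<sigma>. \<sigma> k) {1..n}"
    unfolding rademacher_pmf_def by (rule indep_vars_Pi_pmf) simp
  then have "prob_space.indep_vars (rademacher_pmf n) (\<lambda>_. count_space UNIV) (\<lambda>k \<sigma>. \<sigma> k) {i, j}"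
    by (rule prob_space.indep_vars_subset[OF measure_pmf.prob_space_axioms]) (use assms in auto)
  \<comment> \<open>Composing with the identity replaces the discrete sigma-algebra by the Borel
    one, as the product rule for expectations requires.\<close>
  then have "prob_space.indep_vars (rademacher_pmf n) (\<lambda>_. borel) (\<lambda>k \<sigma>. \<sigma> k) {i, j}"
    by (rule prob_space.indep_vars_compose2[OF measure_pmf.prob_space_axioms, where Y = "\<lambda>_ s. s"]) simp
  then have "?E (\<lambda>\<sigma>. \<Prod>k\<in>{i, j}. \<sigma> k) = (\<Prod>k\<in>{i, j}. ?E (\<lambda>\<sigma>. \<sigma> k))"
    by (intro prob_space.indep_vars_lebesgue_integral[OF measure_pmf.prob_space_axioms]
        integrable_measure_pmf_finite finite_set_rademacher) auto
  then show ?thesis using False mean[OF assms(1)] by simp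
qed

text \<open>Expanding the square leaves only the diagonal terms, since distinct signs are
  uncorrelated. It is applied to matrices with the Frobenius norm.\<close>

lemma expectation_norm_rademacher_sum_sq:
  fixes v :: "nat \<Rightarrow> 'a::real_inner"
  shows "measure_pmf.expectation (rademacher_pmf n) (\<lambda>\<sigma>. (norm (\<Sum>i=1..n. \<sigma> i *\<^sub>R v i))\<^sup>2)
    = (\<Sum>i=1..n. (norm (v i))\<^sup>2)"
proof -
  have int: "integrable (measure_pmf (rademacher_pmf n)) (f :: _ \<Rightarrow> real)" for f
    by (rule integrable_measure_pmf_finite[OF finite_set_rademacher])
  have "measure_pmf.expectation (rademacher_pmf n) (\<lambda>\<sigma>. (norm (\<Sum>i=1..n. \<sigma> i *\<^sub>R v i))\<^sup>2)
      = measure_pmf.expectation (rademacher_pmf n)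
          (\<lambda>\<sigma>. \<Sum>i=1..n. \<Sum>j=1..n. \<sigma> i * \<sigma> j * (v i \<bullet> v j))"
    by (simp add: power2_norm_eq_inner inner_sum_left inner_sum_right sum_distrib_left
        inner_commute mult_ac)
  also have "\<dots> = (\<Sum>i=1..n. \<Sum>j=1..n.
      measure_pmf.expectation (rademacher_pmf n) (\<lambda>\<sigma>. \<sigma> i * \<sigma> j) * (v i \<bullet> v j))"
    by (simp add: int)
  also have "\<dots> = (\<Sum>i=1..n. \<Sum>j=1..n. if i = j then v i \<bullet> v j else 0)"
    by (intro sum.cong refl) (simp add: rademacher_correlation)
  also have "\<dots> = (\<Sum>i=1..n. (norm (v i))\<^sup>2)"
    by (simp add: power2_norm_eq_inner)
  finally show ?thesis .
qed

lemma expectation_norm_rademacher_sum_le: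
  fixes v :: "nat \<Rightarrow> 'a::real_inner"
  assumes "\<And>i. i \<in> {1..n} \<Longrightarrow> norm (v i) \<le> 1"
  shows "measure_pmf.expectation (rademacher_pmf n) (\<lambda>\<sigma>. norm (\<Sum>i=1..n. \<sigma> i *\<^sub>R v i))
    \<le> sqrt (real n)"
proof -
  let ?E = "measure_pmf.expectation (rademacher_pmf n)"
  let ?X = "\<lambda>\<sigma>. norm (\<Sum>i=1..n. \<sigma> i *\<^sub>R v i)"
  have int: "integrable (measure_pmf (rademacher_pmf n)) (f :: _ \<Rightarrow> real)" for f
    by (rule integrable_measure_pmf_finite[OF finite_set_rademacher])
  \<comment> \<open>Jensen's inequality for the square, read off from nonnegativity of the
    variance.\<close>
  have "(?E ?X)\<^sup>2 \<le> ?E (\<lambda>\<sigma>. (?X \<sigma>)\<^sup>2)"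
    using measure_pmf.variance_eq[OF int int, of ?X]
      measure_pmf.variance_positive[of "rademacher_pmf n" ?X] by linarith
  also have "\<dots> \<le> (\<Sum>i=1..n. 1)"
    unfolding expectation_norm_rademacher_sum_sq
    by (intro sum_mono) (simp add: assms power_le_one)
  finally show ?thesis by (simp add: real_le_rsqrt)
qed

theorem proposition3p1:
  fixes n :: nat and \<rho> :: "nat \<Rightarrow> complex^'d^'d"
  assumes "n \<ge> 1"
    and "\<And>i. i \<in> {1..n} \<Longrightarrow> density_matrix (\<rho> i)"
  shows "emp_rademacher n \<rho> H_POVM \<le> sqrt (real CARD('d) / real n)"
proof -
  let ?S = "\<lambda>\<sigma>. \<Sum>i=1..n. \<sigma> i *\<^sub>R \<rho> i"
  let ?c = "sqrt (real CARD('d)) / real n"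
  have int: "integrable (measure_pmf (rademacher_pmf n)) (f :: _ \<Rightarrow> real)" for f
    by (rule integrable_measure_pmf_finite[OF finite_set_rademacher])
  have herm: "hermitian (\<rho> i)" if "i \<in> {1..n}" for i
    using assms(2)[OF that] by (simp add: density_matrix_def psd_def)
  have sup_le: "(SUP M\<in>H_POVM. (1 / real n) * (\<Sum>i=1..n. \<sigma> i * Re (trace (M ** \<rho> i))))
      \<le> ?c * norm (?S \<sigma>)" for \<sigma>
  proof (rule cSUP_least)
    fix M :: "complex^'d^'d" assume M: "M \<in> H_POVM"
    have "(\<Sum>i=1..n. \<sigma> i * Re (trace (M ** \<rho> i))) = M \<bullet> ?S \<sigma>"
      using herm by (simp add: inner_sum_right Re_trace_mult_hermitian)
    also have "\<dots> \<le> norm M * norm (?S \<sigma>)" by (rule norm_cauchy_schwarz)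
    also have "\<dots> \<le> sqrt (real CARD('d)) * norm (?S \<sigma>)"
      by (intro mult_right_mono povm_norm_le M) simp
    finally show "(1 / real n) * (\<Sum>i=1..n. \<sigma> i * Re (trace (M ** \<rho> i))) \<le> ?c * norm (?S \<sigma>)"
      by (simp add: divide_right_mono)
  qed (use zero_in_H_POVM in auto)
  \<comment> \<open>The bound \<open>sup_le\<close> holds for every \<open>\<sigma>\<close>, so it
    integrates pointwise.\<close>
  have "emp_rademacher n \<rho> H_POVM
      \<le> measure_pmf.expectation (rademacher_pmf n) (\<lambda>\<sigma>. ?c * norm (?S \<sigma>))"
    unfolding emp_rademacher_def by (intro integral_mono int sup_le)
  also have "\<dots> = ?c * measure_pmf.expectation (rademacher_pmf n) (\<lambda>\<sigma>. norm (?S \<sigma>))"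
    by simp
  also have "\<dots> \<le> ?c * sqrt (real n)"
    by (intro mult_left_mono expectation_norm_rademacher_sum_le density_matrix_norm_le_1 assms(2))
      auto
  also have "\<dots> = sqrt (real CARD('d) / real n)"
    using assms(1) by (simp add: real_sqrt_divide field_simps)
  finally show ?thesis .
qed

end
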